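(* Let $n$ and $k$ be positive integers. Then the following four sets of partitions have the same cardinality: (a) partitions of $n$ with even mex and exactly $k$ parts greater than $1$; (b) partitions of $n$ with a fixed point and exactly $k+1$ parts greater than $1$; (c) partitions of $n$ with negative crank and exactly $k$ parts greater than $1$; (d) partitions of $n$ with positive crank and exactly $k+1$ parts greater than $1$. That is, $x_e(n,k) = f(n,k+1) = m_{<0}(n,k) = m_{>0}(n,k+1)$.
   Context: A partition of a positive integer $n$ is a finite sequence $\lambda=(\lambda_1,\ldots,\lambda_t)$ of positive integers (the parts) with $\lambda_1\ge\cdots\ge\lambda_t$ and sum $n$. Parts are counted with multiplicity. The mex of $\lambda$ is the smallest positive integer that is not a part of $\lambda$. The partition $\lambda$ has a fixed point if $\lambda_i=i$ for some index $i$ with $1\le i\le t$. Let $\omega(\lambda)$ be the number of parts of $\lambda$ equal to $1$, and let $\mu(\lambda)$ be the number of parts of $\lambda$ greater than $\omega(\lambda)$. The crank of $\lambda$ is $$\mathrm{crank}(\lambda)=\begin{cases}\lambda_1 & \text{if } \omega(\lambda)=0,\\ \mu(\lambda)-\omega(\lambda) & \text{if } \omega(\lambda)>0.\end{cases}$$ For an integer $j \ge 0$, $x_e(n,j)$, $f(n,j)$, $m_{<0}(n,j)$, $m_{>0}(n,j)$ denote the numbers of partitions of $n$ with exactly $j$ parts greater than $1$ that have, respectively, even mex, a fixed point, negative crank, positive crank. *)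

theory Defs
  imports Main
begin

definition partitions :: "nat \<Rightarrow> nat list set" where
  "partitions n = {xs. sorted_wrt (\<ge>) xs \<and> (\<forall>x \<in> set xs. 0 < x) \<and> sum_list xs = n}"

definition mex :: "nat list \<Rightarrow> nat" where
  "mex xs = (LEAST m. 0 < m \<and> m \<notin> set xs)"

(* Parts are indexed from 1 as usual for partitions: the i-th part is xs ! (i - 1). *)
definition has_fixed_point :: "nat list \<Rightarrow> bool" where
  "has_fixed_point xs \<longleftrightarrow> (\<exists>i. 1 \<le> i \<and> i \<le> length xs \<and> xs ! (i - 1) = i)"

definition num_ones :: "nat list \<Rightarrow> nat" where
  "num_ones xs = length (filter (\<lambda>x. x = 1) xs)"

definition num_parts_gt :: "nat \<Rightarrow> nat list \<Rightarrow> nat" where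
  "num_parts_gt m xs = length (filter (\<lambda>x. m < x) xs)"

(* Meaningful for nonempty xs only; partitions of a positive integer are nonempty. *)
definition crank :: "nat list \<Rightarrow> int" where
  "crank xs = (if num_ones xs = 0 then int (hd xs)
     else int (num_parts_gt (num_ones xs) xs) - int (num_ones xs))"

definition x_e :: "nat \<Rightarrow> nat \<Rightarrow> nat" where
  "x_e n j = card {xs \<in> partitions n. num_parts_gt 1 xs = j \<and> even (mex xs)}"

definition f_fixed :: "nat \<Rightarrow> nat \<Rightarrow> nat" where
  "f_fixed n j = card {xs \<in> partitions n. num_parts_gt 1 xs = j \<and> has_fixed_point xs}"

definition m_neg :: "nat \<Rightarrow> nat \<Rightarrow> nat" where
  "m_neg n j = card {xs \<in> partitions n. num_parts_gt 1 xs = j \<and> crank xs < 0}"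

definition m_pos :: "nat \<Rightarrow> nat \<Rightarrow> nat" where
  "m_pos n j = card {xs \<in> partitions n. num_parts_gt 1 xs = j \<and> crank xs > 0}"

(* Ensures that card above is the genuine cardinality. *)
lemma finite_partitions: "finite (partitions n)"
proof (rule finite_subset)
  have len: "length xs \<le> sum_list xs" if "\<forall>x \<in> set xs. 0 < x" for xs :: "nat list"
    using that by (induction xs) auto
  show "partitions n \<subseteq> {xs. set xs \<subseteq> {..n} \<and> length xs \<le> n}"
    using len member_le_sum_list by (fastforce simp: partitions_def)
  show "finite {xs. set xs \<subseteq> {..n} \<and> length xs \<le> n}"
    by (rule finite_lists_length_le) simp
qed

end

theory Submission
  imports Defs
begin

text \<open>
  Write \<open>A(n,k)\<close> for the number of partitions of \<open>n\<close> with \<open>k\<close> parts greater than 1, and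
  call \<open>\<lambda>\<^sub>i = i + s\<close> a fixed point shifted by \<open>s\<close>. If \<open>f\<^sub>s(n,k)\<close> counts the partitions with
  such a point, then deleting the part \<open>\<lambda>\<^sub>i = i + s\<close> and adding 1 to each of the \<open>i - 1\<close> parts
  before it gives a partition of \<open>n - s - 1\<close> with one big part less. The partitions reached are
  exactly those without a fixed point shifted by \<open>s + 1\<close>: the new differences (part minus
  index) are at least \<open>s + 2\<close> before position \<open>i\<close> and at most \<open>s\<close> from there on, and any
  strictly decreasing sequence of differences that avoids \<open>s + 1\<close> jumps over it in this way. Hence
  \<open>f\<^sub>s(n,k+1) + f\<^sub>s\<^sub>+\<^sub>1(n-s-1,k) = A(n-s-1,k)\<close>
  (lemma \<open>shifted_fixed_point_recurrence\<close>); for \<open>s = 0\<close> this needs \<open>k \<ge> 1\<close>.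

  All four numbers of the theorem turn out to be \<open>A(n-1,k) - f\<^sub>1(n-1,k)\<close>. For fixed points this
  is the case \<open>s = 0\<close> of the recurrence.

  The mex is even iff the run of parts \<open>1, 2, 3, \<dots>\<close> has odd length. More generally, consider
  the run that starts at \<open>s + 1\<close>. Deleting one part \<open>s + 1\<close> shows that the partitions where
  this run is odd satisfy the same recurrence as \<open>f\<^sub>s\<close> for \<open>s \<ge> 1\<close>, so they are counted by
  \<open>f\<^sub>s\<close> (lemma \<open>card_odd_run_eq_shifted_fixed_point\<close>). For \<open>s = 0\<close> the deleted part is a 1,
  so the number of big parts does not drop, and this is the shift from \<open>k+1\<close> to \<open>k\<close> between
  fixed points and even mex.

  For the crank, let \<open>\<omega>\<close> be the number of ones, and ask whether more than \<open>\<omega>\<close> parts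
  exceed \<open>\<omega> + s\<close>. For \<open>s = 0\<close> this says that the crank is positive; removing a single 1 turns
  a partition of negative crank into one that violates the condition for \<open>s = 1\<close>. Let the
  Durfee rectangle of size \<open>d\<close> by \<open>d + s\<close> be the largest one of this shape in the diagram. The
  condition is \<open>\<omega> < d\<close>, whereas a shifted fixed point exists iff \<open>\<lambda>\<^sub>d = d + s\<close>, that is, no
  column to the right of the rectangle has height \<open>d\<close>. Breaking the columns of height \<open>d\<close>
  into ones, and collecting the ones in batches of \<open>d\<close>, exchanges the two conditions
  as long as the rectangle is wider than 1, so that its rows are big parts (lemmas \<open>card_shifted_fixed_point_eq_durfee_data\<close> and \<open>card_few_ones_eq_durfee_data\<close>).
\<close>

section \<open>Partitions by number of parts greater than 1\<close>

definition partitions_big :: "nat \<Rightarrow> nat \<Rightarrow> nat list set" where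
  "partitions_big n k = {xs \<in> partitions n. num_parts_gt 1 xs = k}"

definition shifted_fixed_point :: "nat \<Rightarrow> nat list \<Rightarrow> bool" where
  "shifted_fixed_point s xs \<longleftrightarrow> (\<exists>i < length xs. xs ! i = Suc i + s)"

text \<open>
  With \<open>\<omega>\<close> ones, the condition is \<open>\<lambda>\<^sub>i \<ge> i + s\<close> for \<open>i = \<omega> + 1\<close>: row \<open>\<omega> + 1\<close> still
  meets the Durfee rectangle of \<open>d\<close> rows and \<open>d + s\<close> columns, so \<open>\<omega> < d\<close>.
\<close>

definition few_ones :: "nat \<Rightarrow> nat list \<Rightarrow> bool" where
  "few_ones s xs \<longleftrightarrow> num_ones xs < num_parts_gt (num_ones xs + s) xs"

definition mex_above :: "nat \<Rightarrow> nat list \<Rightarrow> nat" where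
  "mex_above s xs = (LEAST m. s < m \<and> m \<notin> set xs)"

text \<open>
  The parts \<open>s + 1, s + 2, \<dots>\<close> that precede the first gap above \<open>s\<close> number
  \<open>mex_above s xs - s - 1\<close>; parity is tested on a sum to avoid truncated subtraction.
\<close>

definition odd_run_above :: "nat \<Rightarrow> nat list \<Rightarrow> bool" where
  "odd_run_above s xs \<longleftrightarrow> even (mex_above s xs + s)"

lemma finite_partitions_big: "finite (partitions_big n k)"
  unfolding partitions_big_def by (rule finite_subset[OF _ finite_partitions[of n]]) auto

lemma card_partitions_big_split:
  "card (partitions_big n k) =
     card {xs \<in> partitions_big n k. P xs} + card {xs \<in> partitions_big n k. \<not> P xs}"
proof -
  have "partitions_big n k = {xs \<in> partitions_big n k. P xs} \<union> {xs \<in> partitions_big n k. \<not> P xs}"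
    by blast
  then show ?thesis
    using card_Un_disjoint[of "{xs \<in> partitions_big n k. P xs}" "{xs \<in> partitions_big n k. \<not> P xs}"]
      finite_partitions_big[of n k] by auto
qed

lemma num_parts_gt_append [simp]: "num_parts_gt m (xs @ ys) = num_parts_gt m xs + num_parts_gt m ys"
  by (simp add: num_parts_gt_def)

lemma num_parts_gt_Cons [simp]:
  "num_parts_gt m (x # xs) = (if m < x then 1 else 0) + num_parts_gt m xs"
  by (simp add: num_parts_gt_def)

lemma num_parts_gt_Nil [simp]: "num_parts_gt m [] = 0"
  by (simp add: num_parts_gt_def)

lemma num_parts_gt_all: "(\<And>x. x \<in> set xs \<Longrightarrow> m < x) \<Longrightarrow> num_parts_gt m xs = length xs"
  by (simp add: num_parts_gt_def)

lemma num_parts_gt_none: "(\<And>x. x \<in> set xs \<Longrightarrow> x \<le> m) \<Longrightarrow> num_parts_gt m xs = 0"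
  by (auto simp add: num_parts_gt_def filter_empty_conv not_less)

lemma num_parts_gt_le_length: "num_parts_gt m xs \<le> length xs"
  by (simp add: num_parts_gt_def)

lemma num_ones_append [simp]: "num_ones (xs @ ys) = num_ones xs + num_ones ys"
  by (simp add: num_ones_def)

lemma num_ones_none: "(\<And>x. x \<in> set xs \<Longrightarrow> 1 < x) \<Longrightarrow> num_ones xs = 0"
  by (auto simp add: num_ones_def filter_empty_conv)

lemma num_ones_replicate [simp]: "num_ones (replicate r (Suc 0)) = r"
  by (simp add: num_ones_def)

lemma sorted_desc_replicate: "sorted_wrt (\<ge>) (replicate r (x :: nat))"
  by (induction r) auto

lemma sorted_desc_map_mono:
  assumes "sorted_wrt (\<ge>) xs" "\<And>x y :: nat. x \<in> set xs \<Longrightarrow> y \<in> set xs \<Longrightarrow> x \<le> y \<Longrightarrow> f x \<le> (f y :: nat)"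
  shows "sorted_wrt (\<ge>) (map f xs)"
  using assms by (induction xs) auto

lemma sorted_desc_append:
  assumes "sorted_wrt (\<ge>) us" "sorted_wrt (\<ge>) vs" "\<forall>x \<in> set us. m \<le> x" "\<forall>x \<in> set vs. x \<le> (m :: nat)"
  shows "sorted_wrt (\<ge>) (us @ vs)"
  unfolding sorted_wrt_append using assms by (meson order_trans)

lemma filter_big_append_ones:
  assumes "sorted_wrt (\<ge>) xs" "\<forall>x \<in> set xs. 0 < x"
  shows "xs = filter (\<lambda>x. 1 < x) xs @ replicate (num_ones xs) (1 :: nat)"
  using assms
proof (induction xs)
  case Nil
  then show ?case by (simp add: num_ones_def)
next
  case (Cons x xs)
  show ?case
  proof (cases "1 < x")
    case True
    then show ?thesis using Cons by (simp add: num_ones_def)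
  next
    case False
    then have "x = 1" "filter (\<lambda>x. 1 < x) xs = []"
      using Cons.prems by (fastforce simp: filter_empty_conv)+
    then show ?thesis using Cons by (simp add: num_ones_def)
  qed
qed

text \<open>
  Lets the number of ones be read off a partition, for the injectivity proofs below.
\<close>

lemma append_ones_eq_iff:
  assumes "\<forall>x \<in> set ws. 1 < x" "\<forall>x \<in> set ws'. (1::nat) < x"
  shows "ws @ replicate r 1 = ws' @ replicate r' 1 \<longleftrightarrow> ws = ws' \<and> r = r'"
proof
  assume e: "ws @ replicate r 1 = ws' @ replicate r' 1"
  from arg_cong[OF e, of "filter (\<lambda>x. 1 < x)"] have "ws = ws'"
    using assms by simp
  then show "ws = ws' \<and> r = r'" using arg_cong[OF e, of length] by simp
qed simp

lemma sorted_desc_last_le: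
  assumes "sorted_wrt (\<ge>) xs" "x \<in> set xs"
  shows "last xs \<le> (x :: nat)"
  using assms by (induction xs) (auto split: if_splits)

section \<open>Durfee rectangles\<close>

text \<open>
  The list is cut after the \<open>d\<close> rows that meet the largest rectangle of \<open>d\<close> rows and
  \<open>d + t\<close> columns in the diagram. Stating this for the two pieces rather than computing
  \<open>d\<close> turns injectivity of maps that reassemble a partition into uniqueness of the cut.
\<close>

definition durfee_split :: "nat \<Rightarrow> nat list \<Rightarrow> nat list \<Rightarrow> bool" where
  "durfee_split t as vs \<longleftrightarrow>
     (\<forall>x \<in> set as. length as + t \<le> x) \<and> (\<forall>x \<in> set vs. x \<le> length as + t)"

text \<open>
  Induction from the end of the list: a new smallest part enlarges the rectangle only if no part
  lies below the rectangle yet and the new part exceeds its width.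
\<close>

lemma durfee_split_exists:
  assumes "sorted_wrt (\<ge>) xs"
  shows "\<exists>as vs. xs = as @ vs \<and> durfee_split t as vs"
  using assms
proof (induction xs rule: rev_induct)
  case Nil
  then show ?case by (auto simp: durfee_split_def)
next
  case (snoc x xs)
  then obtain as vs where xs: "xs = as @ vs" and sp: "durfee_split t as vs"
    by (auto simp: sorted_wrt_append)
  have le: "\<forall>y \<in> set xs. x \<le> y"
    using snoc.prems by (auto simp: sorted_wrt_append)
  show ?case
  proof (cases "vs = [] \<and> length as + t < x")
    case True
    then have "durfee_split t (as @ [x]) []"
      using le xs by (fastforce simp: durfee_split_def)
    then show ?thesis using True xs by force
  next
    case False
    have "x \<le> length as + t"
    proof (cases vs)
      case Nil then show ?thesis using False by auto
    next
      case (Cons v vs')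
      then show ?thesis using le xs sp by (force simp: durfee_split_def)
    qed
    then have "durfee_split t as (vs @ [x])" using sp by (auto simp: durfee_split_def)
    then show ?thesis using xs by force
  qed
qed

text \<open>
  Were the second cut later, the row just after the first cut would have to be both wider
  than \<open>length as + t\<close> and at most that wide.
\<close>

lemma durfee_split_unique_le:
  assumes "as @ vs = bs @ ws" "durfee_split t as vs" "durfee_split t bs ws"
  shows "length bs \<le> length as"
proof (rule ccontr)
  assume "\<not> ?thesis"
  then have len: "length as < length bs" by simp
  have eq: "bs ! length as = vs ! 0" and "vs \<noteq> []"
    using arg_cong[OF assms(1), of "\<lambda>l. l ! length as"] arg_cong[OF assms(1), of length] len
    by (auto simp: nth_append)
  then have "vs ! 0 \<in> set vs" by simp
  moreover have "bs ! length as \<in> set bs" using len by simp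
  ultimately show False using assms eq len unfolding durfee_split_def by fastforce
qed

lemma durfee_split_unique:
  assumes "as @ vs = bs @ ws" "durfee_split t as vs" "durfee_split t bs ws"
  shows "as = bs \<and> vs = ws"
  using durfee_split_unique_le[OF assms] durfee_split_unique_le[OF assms(1)[symmetric] assms(3,2)]
    assms(1) by auto

text \<open>
  Rows of the rectangle are at least \<open>d + s\<close> wide and rows below it at most \<open>d + s\<close>, so only
  row \<open>d\<close>, the last one of the rectangle, can have width equal to its index plus \<open>s\<close>.
\<close>

lemma shifted_fixed_point_iff_split:
  assumes so: "sorted_wrt (\<ge>) (as @ vs)" and sp: "durfee_split s as vs"
  shows "shifted_fixed_point s (as @ vs) \<longleftrightarrow> as \<noteq> [] \<and> last as = length as + s"
proof
  assume "shifted_fixed_point s (as @ vs)"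
  then obtain i where i: "i < length (as @ vs)" "(as @ vs) ! i = Suc i + s"
    by (auto simp: shifted_fixed_point_def)
  have il: "i < length as"
  proof (rule ccontr)
    assume "\<not> i < length as"
    then have "(as @ vs) ! i \<in> set vs" using i(1) by (auto simp: nth_append)
    then have "(as @ vs) ! i \<le> length as + s" using sp by (auto simp: durfee_split_def)
    with i \<open>\<not> i < length as\<close> show False by simp
  qed
  then have "as ! i = Suc i + s" "as ! i \<in> set as" using i nth_mem[OF il] by (auto simp: nth_append)
  then have "length as + s \<le> Suc i + s" using sp by (metis durfee_split_def)
  then have "Suc i = length as" using il by simp
  then show "as \<noteq> [] \<and> last as = length as + s"
    using \<open>as ! i = Suc i + s\<close> by (metis diff_Suc_1 last_conv_nth length_0_conv nat.simps(3))
next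
  assume r: "as \<noteq> [] \<and> last as = length as + s"
  then have "(as @ vs) ! (length as - 1) = Suc (length as - 1) + s"
    using last_conv_nth[of as] by (simp add: nth_append)
  moreover have "length as - 1 < length (as @ vs)"
    using r by (metis diff_less length_append length_greater_0_conv less_numeral_extra(1) trans_less_add1)
  ultimately show "shifted_fixed_point s (as @ vs)"
    unfolding shifted_fixed_point_def by blast
qed

lemma few_ones_iff_split:
  assumes sp: "durfee_split s as vs"
  shows "few_ones s (as @ vs) \<longleftrightarrow> num_ones (as @ vs) < length as"
proof -
  define w where "w = num_ones (as @ vs)"
  have "w < num_parts_gt (w + s) (as @ vs) \<longleftrightarrow> w < length as"
  proof (cases "w < length as")
    case True
    then have "num_parts_gt (w + s) as = length as"
      using sp by (intro num_parts_gt_all) (force simp: durfee_split_def)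
    then show ?thesis using True by simp
  next
    case False
    then have "num_parts_gt (w + s) vs = 0"
      using sp by (intro num_parts_gt_none) (force simp: durfee_split_def)
    then show ?thesis using False num_parts_gt_le_length[of "w + s" as] by simp
  qed
  then show ?thesis by (simp add: few_ones_def w_def)
qed

section \<open>A recurrence for shifted fixed points\<close>

text \<open>
  The rows above and below a shifted fixed point in position \<open>length us + 1\<close>. The numbers \<open>n\<close>
  and \<open>k\<close> belong to the partition in which the fixed point is deleted and the rows above
  it are lengthened by 1. The condition \<open>0 < length us + s\<close> says that the fixed point is a part
  greater than 1.
\<close>

definition fixed_point_data :: "nat \<Rightarrow> nat \<Rightarrow> nat \<Rightarrow> (nat list \<times> nat list) set" where
  "fixed_point_data s n k = {(us, vs). sorted_wrt (\<ge>) us \<and> sorted_wrt (\<ge>) vs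
     \<and> (\<forall>x \<in> set us. Suc (length us) + s \<le> x) \<and> (\<forall>x \<in> set vs. 0 < x \<and> x \<le> Suc (length us) + s)
     \<and> 0 < length us + s
     \<and> sum_list us + length us + sum_list vs = n \<and> length us + num_parts_gt 1 vs = k}"

lemma sum_list_map_Suc: "sum_list (map Suc xs) = sum_list xs + length xs"
  by (induction xs) auto

lemma sum_list_map_add: "sum_list (map (\<lambda>x. x + c) xs) = sum_list xs + c * length xs" for c :: nat
  by (induction xs) auto

lemma card_shifted_fixed_point_data:
  assumes "0 < s \<or> 0 < k"
  shows "card {xs \<in> partitions_big (n + Suc s) (Suc k). shifted_fixed_point s xs} =
    card (fixed_point_data s n k)"
proof -
  define g where "g = (\<lambda>(us, vs). us @ (Suc (length us) + s) # (vs :: nat list))"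
  have sp: "durfee_split s (us @ [Suc (length us) + s]) vs"
    if "(us, vs) \<in> fixed_point_data s n k" for us vs
    using that by (auto simp: fixed_point_data_def durfee_split_def)
  have "inj_on g (fixed_point_data s n k)"
  proof (rule inj_onI, clarify)
    fix us vs us' vs'
    assume a: "(us, vs) \<in> fixed_point_data s n k" "(us', vs') \<in> fixed_point_data s n k"
      "g (us, vs) = g (us', vs')"
    then have "(us @ [Suc (length us) + s]) @ vs = (us' @ [Suc (length us') + s]) @ vs'"
      by (simp add: g_def)
    from durfee_split_unique[OF this sp[OF a(1)] sp[OF a(2)]] show "us = us' \<and> vs = vs'"
      by simp
  qed
  moreover have "g ` fixed_point_data s n k =
    {xs \<in> partitions_big (n + Suc s) (Suc k). shifted_fixed_point s xs}"
  proof (intro equalityI subsetI)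
    fix xs assume "xs \<in> g ` fixed_point_data s n k"
    then obtain us vs where uv: "(us, vs) \<in> fixed_point_data s n k" and xs: "xs = g (us, vs)" by auto
    have "num_parts_gt 1 us = length us"
    proof (rule num_parts_gt_all)
      fix x assume "x \<in> set us"
      then have "0 < length us" "Suc (length us) + s \<le> x"
        using uv length_pos_if_in_set[of x us] unfolding fixed_point_data_def by blast+
      then show "1 < x" by linarith
    qed
    moreover have "sorted_wrt (\<ge>) xs"
      using uv sorted_desc_append[of us vs "Suc (length us) + s"] unfolding xs g_def fixed_point_data_def
      by (auto simp: sorted_wrt_append)
    moreover have "\<forall>x \<in> set xs. 0 < x"
      using uv unfolding xs g_def fixed_point_data_def by force
    ultimately have "xs \<in> partitions_big (n + Suc s) (Suc k)"
      using uv unfolding xs g_def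
      by (auto simp: fixed_point_data_def partitions_big_def partitions_def)
    moreover have "shifted_fixed_point s xs"
      unfolding shifted_fixed_point_def xs g_def by (auto intro!: exI[of _ "length us"])
    ultimately show "xs \<in> {xs \<in> partitions_big (n + Suc s) (Suc k). shifted_fixed_point s xs}" by simp
  next
    fix xs assume "xs \<in> {xs \<in> partitions_big (n + Suc s) (Suc k). shifted_fixed_point s xs}"
    then have so: "sorted_wrt (\<ge>) xs" and pos: "\<forall>x\<in>set xs. 0 < x" and sum: "sum_list xs = n + Suc s"
      and num: "num_parts_gt 1 xs = Suc k" and fp: "shifted_fixed_point s xs"
      by (auto simp: partitions_big_def partitions_def)
    obtain as vs where xs: "xs = as @ vs" and dsp: "durfee_split s as vs"
      using durfee_split_exists[OF so] by blast
    have "as \<noteq> []" "last as = length as + s"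
      using shifted_fixed_point_iff_split[of as vs s] so fp dsp xs by auto
    then obtain us where as: "as = us @ [Suc (length us) + s]"
      by (metis add_Suc append_butlast_last_id length_append_singleton)
    \<comment> \<open>A fixed point in the first row with no shift would be the part 1, leaving no part greater than 1.\<close>
    have nz: "0 < length us + s"
    proof (rule ccontr)
      assume "\<not> 0 < length us + s"
      then have "us = []" "s = 0" by auto
      then have "num_parts_gt 1 xs = 0"
        using dsp xs as by (intro num_parts_gt_none) (auto simp: durfee_split_def)
      then show False using num by simp
    qed
    have us: "num_parts_gt 1 us = length us"
    proof (rule num_parts_gt_all)
      fix x assume "x \<in> set us"
      then have "length as + s \<le> x" using dsp as by (auto simp: durfee_split_def)
      moreover have "length as = Suc (length us)" using as by simp
      ultimately show "1 < x" using nz by linarith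
    qed
    have "(us, vs) \<in> fixed_point_data s n k"
      using so pos sum num us nz dsp unfolding xs as fixed_point_data_def durfee_split_def
      by (auto simp: sorted_wrt_append)
    moreover have "xs = g (us, vs)" by (simp add: xs as g_def)
    ultimately show "xs \<in> g ` fixed_point_data s n k" by blast
  qed
  ultimately show ?thesis by (metis card_image)
qed

text \<open>
  Without a fixed point shifted by \<open>s + 1\<close>, all rows of the rectangle for that shift are
  wider than the rectangle, so a cell can be removed from each of them and the deleted fixed
  point put back underneath.
\<close>

lemma card_no_shifted_fixed_point_data:
  assumes "0 < s \<or> 0 < k"
  shows "card {xs \<in> partitions_big n k. \<not> shifted_fixed_point (Suc s) xs} =
    card (fixed_point_data s n k)"
proof -
  define g where "g = (\<lambda>(us, vs). map Suc us @ (vs :: nat list))"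
  have sp: "durfee_split (Suc s) (map Suc us) vs"
    if "(us, vs) \<in> fixed_point_data s n k" for us vs
    using that by (fastforce simp: fixed_point_data_def durfee_split_def)
  have "inj_on g (fixed_point_data s n k)"
  proof (rule inj_onI, clarify)
    fix us vs us' vs'
    assume a: "(us, vs) \<in> fixed_point_data s n k" "(us', vs') \<in> fixed_point_data s n k"
      "g (us, vs) = g (us', vs')"
    then have "map Suc us @ vs = map Suc us' @ vs'"
      by (simp add: g_def)
    from durfee_split_unique[OF this sp[OF a(1)] sp[OF a(2)]] show "us = us' \<and> vs = vs'"
      by (simp add: inj_map_eq_map)
  qed
  moreover have "g ` fixed_point_data s n k =
    {xs \<in> partitions_big n k. \<not> shifted_fixed_point (Suc s) xs}"
  proof (intro equalityI subsetI)
    fix xs assume "xs \<in> g ` fixed_point_data s n k"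
    then obtain us vs where uv: "(us, vs) \<in> fixed_point_data s n k" and xs: "xs = map Suc us @ vs"
      by (auto simp: g_def)
    have "num_parts_gt 1 (map Suc us) = length us"
      using uv num_parts_gt_all[of "map Suc us" 1] by (fastforce simp: fixed_point_data_def)
    moreover have so: "sorted_wrt (\<ge>) xs"
      using uv unfolding xs fixed_point_data_def
      by (fastforce simp: sorted_wrt_append sorted_wrt_map)
    ultimately have "xs \<in> partitions_big n k"
      using uv unfolding xs
      by (auto simp: fixed_point_data_def partitions_big_def partitions_def sum_list_map_Suc)
    moreover have "\<not> shifted_fixed_point (Suc s) xs"
    proof
      assume "shifted_fixed_point (Suc s) xs"
      then have l: "us \<noteq> []" "last (map Suc us) = length us + Suc s"
        using shifted_fixed_point_iff_split[OF so[unfolded xs] sp[OF uv]] xs by auto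
      then have "last us = length us + s" "last us \<in> set us"
        using last_in_set[OF l(1)] by (auto simp: last_map)
      then show False using uv by (fastforce simp: fixed_point_data_def)
    qed
    ultimately show "xs \<in> {xs \<in> partitions_big n k. \<not> shifted_fixed_point (Suc s) xs}" by simp
  next
    fix xs assume "xs \<in> {xs \<in> partitions_big n k. \<not> shifted_fixed_point (Suc s) xs}"
    then have so: "sorted_wrt (\<ge>) xs" and pos: "\<forall>x\<in>set xs. 0 < x" and sum: "sum_list xs = n"
      and num: "num_parts_gt 1 xs = k" and fp: "\<not> shifted_fixed_point (Suc s) xs"
      by (auto simp: partitions_big_def partitions_def)
    obtain as vs where xs: "xs = as @ vs" and dsp: "durfee_split (Suc s) as vs"
      using durfee_split_exists[OF so] by blast
    have nl: "as = [] \<or> last as \<noteq> length as + Suc s"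
      using shifted_fixed_point_iff_split[of as vs "Suc s"] so fp dsp xs by auto
    have big: "length as + Suc (Suc s) \<le> x" if "x \<in> set as" for x
    proof -
      have ne: "as \<noteq> []" using that by auto
      then have "last as \<le> x"
        using that so sorted_desc_last_le[of as x] by (auto simp: xs sorted_wrt_append)
      moreover have "length as + Suc s \<le> last as"
        using ne dsp by (auto simp: durfee_split_def)
      ultimately show ?thesis using nl ne by auto
    qed
    define us where "us = map (\<lambda>x. x - 1) as"
    have as: "as = map Suc us"
      unfolding us_def using big by (force intro!: map_idI[symmetric])
    have nz: "0 < length us + s"
    proof (rule ccontr)
      assume "\<not> 0 < length us + s"
      then have "us = []" "s = 0" by auto
      then have "num_parts_gt 1 xs = 0"
        using dsp xs as by (intro num_parts_gt_none) (auto simp: durfee_split_def)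
      then show False using num assms \<open>s = 0\<close> by simp
    qed
    have us: "num_parts_gt 1 as = length us"
      using num_parts_gt_all[of as 1] big as by fastforce
    have "(us, vs) \<in> fixed_point_data s n k"
      using so pos sum num us nz dsp big unfolding xs as fixed_point_data_def durfee_split_def
      by (auto simp: sorted_wrt_append sorted_wrt_map sum_list_map_Suc)
    moreover have "xs = g (us, vs)" by (simp add: xs as g_def)
    ultimately show "xs \<in> g ` fixed_point_data s n k" by blast
  qed
  ultimately show ?thesis by (metis card_image)
qed

lemma shifted_fixed_point_recurrence:
  assumes "0 < s \<or> 0 < k"
  shows "card {xs \<in> partitions_big (n + Suc s) (Suc k). shifted_fixed_point s xs}
    + card {xs \<in> partitions_big n k. shifted_fixed_point (Suc s) xs} = card (partitions_big n k)"
  using card_shifted_fixed_point_data[OF assms] card_no_shifted_fixed_point_data[OF assms]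
    card_partitions_big_split[of n k "shifted_fixed_point (Suc s)"] by simp


section \<open>Trading ones for full columns beside the Durfee rectangle\<close>

text \<open>
  The common core of both families of partitions: \<open>bs\<close> are the rows of the rectangle after
  all \<open>c\<close> columns of height \<open>length bs\<close> to its right have been removed, \<open>ws\<close> are the parts
  below it that exceed 1, and \<open>r\<close> is the remainder of the number of ones modulo
  \<open>length bs\<close>. The \<open>c * length bs\<close> cells become either ones or full columns. The rectangle has
  to be wider than 1, since otherwise its own rows could be ones.
\<close>

definition durfee_data :: "nat \<Rightarrow> nat \<Rightarrow> nat \<Rightarrow> (nat list \<times> nat list \<times> nat \<times> nat) set" where
  "durfee_data s n k = {(bs, ws, c, r). sorted_wrt (\<ge>) bs \<and> bs \<noteq> [] \<and> last bs = length bs + s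
     \<and> (\<forall>x \<in> set bs. length bs + s \<le> x)
     \<and> sorted_wrt (\<ge>) ws \<and> (\<forall>x \<in> set ws. 1 < x \<and> x \<le> length bs + s)
     \<and> r < length bs \<and> 1 < length bs + s
     \<and> sum_list bs + sum_list ws + c * length bs + r = n \<and> length bs + length ws = k}"

text \<open>
  A rectangle of width 1 with \<open>s = 0\<close> allows only one part greater than 1.
\<close>

lemma durfee_side_gt_1:
  assumes "durfee_split s as vs" "as \<noteq> []" "0 < s \<or> 1 < num_parts_gt 1 (as @ vs)"
  shows "1 < length as + s"
proof (rule ccontr)
  assume "\<not> ?thesis"
  then have l: "length as = 1" "s = 0" using assms(2) by (cases as; auto)+
  then have "num_parts_gt 1 vs = 0"
    using assms(1) by (intro num_parts_gt_none) (auto simp: durfee_split_def)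
  then show False using assms(3) l num_parts_gt_le_length[of 1 as] by simp
qed

text \<open>
  Covers both reassemblies: \<open>as\<close> is \<open>bs\<close> with or without the full columns, and \<open>q\<close> is the
  number of ones that makes up for the difference in size.
\<close>

lemma durfee_data_with_ones:
  assumes d: "(bs, ws, c, r) \<in> durfee_data s n k"
    and as: "sorted_wrt (\<ge>) as" "length as = length bs" "\<forall>x \<in> set as. length bs + s \<le> x"
    and sum: "sum_list as + q = sum_list bs + c * length bs + r"
  shows "as @ ws @ replicate q 1 \<in> partitions_big n k"
    and "durfee_split s as (ws @ replicate q 1)"
    and "num_ones (as @ ws @ replicate q 1) = q"
proof -
  have side: "1 < length bs + s" and ws: "\<forall>x \<in> set ws. 1 < x" "\<forall>x \<in> set ws. x \<le> length bs + s"
    and sws: "sorted_wrt (\<ge>) ws"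
    using d by (auto simp: durfee_data_def)
  have tail: "\<forall>x \<in> set (ws @ replicate q 1). x \<le> length bs + s"
    using side ws by auto
  have big: "\<forall>x \<in> set (as @ ws). 1 < x"
    using as(3) ws(1) less_le_trans[OF side] by auto
  have "sorted_wrt (\<ge>) (ws @ replicate q 1)"
    using sorted_desc_append[OF sws sorted_desc_replicate[of q 1], of 1] ws by (auto simp: less_imp_le)
  then have "sorted_wrt (\<ge>) (as @ ws @ replicate q 1)"
    using sorted_desc_append[OF as(1)] as(3) tail by blast
  moreover have "\<forall>x \<in> set (as @ ws @ replicate q 1). 0 < x" using big by fastforce
  moreover have "num_parts_gt 1 (as @ ws @ replicate q 1) = k"
  proof -
    have "num_parts_gt 1 (as @ ws) = length (as @ ws)"
      using big by (intro num_parts_gt_all) blast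
    moreover have "num_parts_gt 1 (replicate q 1) = 0" by (intro num_parts_gt_none) auto
    moreover have "length bs + length ws = k" using d by (auto simp: durfee_data_def)
    ultimately show ?thesis using as(2) by simp
  qed
  moreover have "sum_list (as @ ws @ replicate q 1) = n"
    using d sum by (auto simp: durfee_data_def sum_list_replicate)
  ultimately show "as @ ws @ replicate q 1 \<in> partitions_big n k"
    unfolding partitions_big_def partitions_def by blast
  show "durfee_split s as (ws @ replicate q 1)"
    using as tail by (simp add: durfee_split_def)
  show "num_ones (as @ ws @ replicate q 1) = q"
    using num_ones_none[of "as @ ws"] big by simp
qed

lemma partitions_big_cases:
  assumes xs: "xs \<in> partitions_big n k" and k: "0 < s \<or> 1 < k"
  obtains as ws q where
    "xs = as @ ws @ replicate q 1" "durfee_split s as (ws @ replicate q 1)"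
    "sorted_wrt (\<ge>) as" "\<forall>x \<in> set as. length as + s \<le> x"
    "sorted_wrt (\<ge>) ws" "\<forall>x \<in> set ws. 1 < x \<and> x \<le> length as + s"
    "as \<noteq> [] \<longrightarrow> 1 < length as + s" "length as + length ws = k"
    "sum_list as + sum_list ws + q = n" "num_ones xs = q"
proof -
  have so: "sorted_wrt (\<ge>) xs" and pos: "\<forall>x\<in>set xs. 0 < x" and sum: "sum_list xs = n"
    and num: "num_parts_gt 1 xs = k"
    using xs by (auto simp: partitions_big_def partitions_def)
  obtain as vs where xs: "xs = as @ vs" and sp: "durfee_split s as vs"
    using durfee_split_exists[OF so] by blast
  define ws where "ws = filter (\<lambda>x. 1 < x) vs"
  define q where "q = num_ones vs"
  have vs: "vs = ws @ replicate q 1"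
    unfolding ws_def q_def using so pos xs by (intro filter_big_append_ones) (auto simp: sorted_wrt_append)
  have side: "1 < length as + s" if "as \<noteq> []"
    using durfee_side_gt_1[OF sp that] k num xs by simp
  have big: "\<forall>x \<in> set as. 1 < x"
  proof
    fix x assume "x \<in> set as"
    then have "as \<noteq> []" "length as + s \<le> x" using sp by (auto simp: durfee_split_def)
    then show "1 < x" using side by simp
  qed
  then have o: "num_ones xs = q" using xs num_ones_none[of as] by (simp add: q_def)
  have len: "length as + length ws = k"
    using num_parts_gt_all[of as 1] big num by (simp add: xs ws_def num_parts_gt_def)
  have "\<forall>x \<in> set ws. 1 < x \<and> x \<le> length as + s"
    using sp by (auto simp: ws_def durfee_split_def)
  moreover have "sorted_wrt (\<ge>) as" "sorted_wrt (\<ge>) ws"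
    using so by (auto simp: xs ws_def sorted_wrt_append intro: sorted_wrt_filter)
  moreover have "sum_list vs = sum_list ws + q"
    unfolding vs by (simp add: sum_list_replicate)
  moreover have "xs = as @ ws @ replicate q 1" unfolding xs vs ..
  moreover have "durfee_split s as (ws @ replicate q 1)" using sp unfolding vs .
  moreover from this have "\<forall>x \<in> set as. length as + s \<le> x" by (simp add: durfee_split_def)
  moreover have "sum_list as + sum_list vs = n" using sum xs by simp
  ultimately show ?thesis
    using that[of as ws q] o side len by simp
qed

lemma card_shifted_fixed_point_eq_durfee_data:
  assumes "0 < s \<or> 1 < k"
  shows "card {xs \<in> partitions_big n k. shifted_fixed_point s xs} = card (durfee_data s n k)"
proof -
  define g where "g = (\<lambda>(bs, ws, c, r). bs @ ws @ replicate (r + c * length bs) (1 :: nat))"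
  note img = durfee_data_with_ones
  have d: "sorted_wrt (\<ge>) bs" "\<forall>x \<in> set bs. length bs + s \<le> x" "bs \<noteq> []" "last bs = length bs + s"
    "\<forall>x \<in> set ws. 1 < x" "r < length bs"
    if "(bs, ws, c, r) \<in> durfee_data s n k" for bs ws c r
    using that by (auto simp: durfee_data_def)
  have "inj_on g (durfee_data s n k)"
  proof (rule inj_onI, clarify)
    fix bs ws c r bs' ws' c' r'
    assume a: "(bs, ws, c, r) \<in> durfee_data s n k" "(bs', ws', c', r') \<in> durfee_data s n k"
      "g (bs, ws, c, r) = g (bs', ws', c', r')"
    note img(2)[OF a(1) d(1)[OF a(1)] refl d(2)[OF a(1)], of "r + c * length bs"]
      img(2)[OF a(2) d(1)[OF a(2)] refl d(2)[OF a(2)], of "r' + c' * length bs'"]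
    with durfee_split_unique[OF a(3)[unfolded g_def prod.case]]
    have bs: "bs = bs'" and "ws @ replicate (r + c * length bs) 1 = ws' @ replicate (r' + c' * length bs') 1"
      by simp_all
    then have ws: "ws = ws'" and "r + c * length bs = r' + c' * length bs"
      using append_ones_eq_iff[OF d(5)[OF a(1)] d(5)[OF a(2)]] by auto
    moreover from this have "(r + c * length bs) mod length bs = (r' + c' * length bs) mod length bs"
      by simp
    then have "r = r'" using bs d(6)[OF a(1)] d(6)[OF a(2)] by simp
    ultimately show "bs = bs' \<and> (ws, c, r) = (ws', c', r')"
      using bs ws d(3)[OF a(1)] by simp
  qed
  moreover have "g ` durfee_data s n k = {xs \<in> partitions_big n k. shifted_fixed_point s xs}"
  proof (intro equalityI subsetI)
    fix xs assume "xs \<in> g ` durfee_data s n k"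
    then obtain bs ws c r where a: "(bs, ws, c, r) \<in> durfee_data s n k"
      and xs: "xs = bs @ ws @ replicate (r + c * length bs) 1"
      by (auto simp: g_def)
    note i = img[OF a d(1)[OF a] refl d(2)[OF a], of "r + c * length bs", folded xs]
    have "sorted_wrt (\<ge>) xs" using i(1) by (simp add: partitions_big_def partitions_def)
    then have "shifted_fixed_point s xs"
      using shifted_fixed_point_iff_split[OF _ i(2)] d(3,4)[OF a] xs by simp
    then show "xs \<in> {xs \<in> partitions_big n k. shifted_fixed_point s xs}" using i(1) by simp
  next
    fix xs assume "xs \<in> {xs \<in> partitions_big n k. shifted_fixed_point s xs}"
    then have x: "xs \<in> partitions_big n k" and fp: "shifted_fixed_point s xs" by auto
    then have so: "sorted_wrt (\<ge>) xs" by (simp add: partitions_big_def partitions_def)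
    obtain as ws q where
      c: "xs = as @ ws @ replicate q 1" "durfee_split s as (ws @ replicate q 1)"
      "sorted_wrt (\<ge>) as" "\<forall>x \<in> set as. length as + s \<le> x"
      "sorted_wrt (\<ge>) ws" "\<forall>x \<in> set ws. 1 < x \<and> x \<le> length as + s"
      "as \<noteq> [] \<longrightarrow> 1 < length as + s" "length as + length ws = k"
      "sum_list as + sum_list ws + q = n" "num_ones xs = q"
      by (rule partitions_big_cases[OF x assms])
    have l: "as \<noteq> []" "last as = length as + s"
      using shifted_fixed_point_iff_split[of as "ws @ replicate q 1" s] c(1,2) so fp by auto
    \<comment> \<open>Division with remainder by the height of the rectangle collects the ones into columns.\<close>
    define c' r where "c' = q div length as" and "r = q mod length as"
    have cr: "r + c' * length as = q" by (simp add: c'_def r_def)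
    have "r < length as" using l by (simp add: r_def)
    then have "(as, ws, c', r) \<in> durfee_data s n k"
      using c l cr unfolding durfee_data_def by auto
    moreover have "xs = g (as, ws, c', r)" using c(1) cr by (simp add: g_def)
    ultimately show "xs \<in> g ` durfee_data s n k" by blast
  qed
  ultimately show ?thesis by (metis card_image)
qed

lemma card_few_ones_eq_durfee_data:
  assumes "0 < s \<or> 1 < k"
  shows "card {xs \<in> partitions_big n k. few_ones s xs} = card (durfee_data s n k)"
proof -
  define g where "g = (\<lambda>(bs, ws, c, r). map (\<lambda>x. x + c) bs @ ws @ replicate r (1 :: nat))"
  have d: "sorted_wrt (\<ge>) (map (\<lambda>x. x + c) bs)" "\<forall>x \<in> set (map (\<lambda>x. x + c) bs). length bs + s \<le> x"
    "bs \<noteq> []" "last bs = length bs + s"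
    "\<forall>x \<in> set ws. 1 < x" "r < length bs" "sum_list (map (\<lambda>x. x + c) bs) + r = sum_list bs + c * length bs + r"
    if "(bs, ws, c, r) \<in> durfee_data s n k" for bs ws c r
    using that by (auto simp: durfee_data_def sum_list_map_add sorted_wrt_map trans_le_add1)
  note img = durfee_data_with_ones[OF _ d(1) length_map d(2) d(7)]
  have "inj_on g (durfee_data s n k)"
  proof (rule inj_onI, clarify)
    fix bs ws c r bs' ws' c' r'
    assume a: "(bs, ws, c, r) \<in> durfee_data s n k" "(bs', ws', c', r') \<in> durfee_data s n k"
      "g (bs, ws, c, r) = g (bs', ws', c', r')"
    have bs: "map (\<lambda>x. x + c) bs = map (\<lambda>x. x + c') bs'"
      and "ws @ replicate r 1 = ws' @ replicate r' 1"
      using durfee_split_unique[OF a(3)[unfolded g_def prod.case]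
        img(2)[OF a(1) a(1) a(1) a(1)] img(2)[OF a(2) a(2) a(2) a(2)]] by simp_all
    then have ws: "ws = ws'" "r = r'"
      using append_ones_eq_iff[OF d(5)[OF a(1)] d(5)[OF a(2)]] by auto
    have "length bs = length bs'" using arg_cong[OF bs, of length] by simp
    moreover have "last bs + c = last bs' + c'"
      using arg_cong[OF bs, of last] d(3)[OF a(1)] d(3)[OF a(2)] by (simp add: last_map)
    ultimately have "c = c'" using d(4)[OF a(1)] d(4)[OF a(2)] by simp
    moreover from this have "bs = bs'" using bs by (simp add: inj_map_eq_map)
    ultimately show "bs = bs' \<and> (ws, c, r) = (ws', c', r')" using ws by simp
  qed
  moreover have "g ` durfee_data s n k = {xs \<in> partitions_big n k. few_ones s xs}"
  proof (intro equalityI subsetI)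
    fix xs assume "xs \<in> g ` durfee_data s n k"
    then obtain bs ws c r where a: "(bs, ws, c, r) \<in> durfee_data s n k"
      and xs: "xs = map (\<lambda>x. x + c) bs @ ws @ replicate r 1"
      by (auto simp: g_def)
    note i = img[OF a a a a, folded xs]
    have "few_ones s xs"
      using few_ones_iff_split[OF i(2), folded xs] i(3) d(6)[OF a] by simp
    then show "xs \<in> {xs \<in> partitions_big n k. few_ones s xs}" using i(1) by simp
  next
    fix xs assume "xs \<in> {xs \<in> partitions_big n k. few_ones s xs}"
    then have x: "xs \<in> partitions_big n k" and few: "few_ones s xs" by auto
    obtain as ws q where
      c: "xs = as @ ws @ replicate q 1" "durfee_split s as (ws @ replicate q 1)"
      "sorted_wrt (\<ge>) as" "\<forall>x \<in> set as. length as + s \<le> x"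
      "sorted_wrt (\<ge>) ws" "\<forall>x \<in> set ws. 1 < x \<and> x \<le> length as + s"
      "as \<noteq> [] \<longrightarrow> 1 < length as + s" "length as + length ws = k"
      "sum_list as + sum_list ws + q = n" "num_ones xs = q"
      by (rule partitions_big_cases[OF x assms])
    have l: "q < length as"
      using few_ones_iff_split[OF c(2)] c(1,10) few by simp
    then have ne: "as \<noteq> []" by auto
    \<comment> \<open>The overhang of the last row beside the rectangle is the number of full columns.\<close>
    define c' bs where "c' = last as - (length as + s)" and "bs = map (\<lambda>x. x - c') as"
    have "length as + s \<le> last as" using c(4) last_in_set[OF ne] by blast
    then have la: "last as = c' + length as + s" by (simp add: c'_def)
    have ge: "c' + length as + s \<le> x" if "x \<in> set as" for x
      using sorted_desc_last_le[OF c(3) that] unfolding la .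
    have "map (\<lambda>x. x + c') bs = as"
      unfolding bs_def map_map
    proof (rule map_idI)
      fix x assume "x \<in> set as"
      from ge[OF this] show "((\<lambda>x. x + c') \<circ> (\<lambda>x. x - c')) x = x" by simp
    qed
    note as = this[symmetric]
    have len: "length bs = length as" by (simp add: bs_def)
    have "sorted_wrt (\<ge>) bs"
      unfolding bs_def using c(3) by (rule sorted_desc_map_mono) simp
    moreover have "last bs = length bs + s" using la ne len by (simp add: bs_def last_map)
    moreover have "\<forall>x \<in> set bs. length bs + s \<le> x"
    proof
      fix y assume "y \<in> set bs"
      then obtain x where "x \<in> set as" "y = x - c'" by (auto simp: bs_def)
      then show "length bs + s \<le> y" using ge[of x] len by simp
    qed
    moreover have "sum_list as = sum_list bs + c' * length bs"
      unfolding as by (simp add: sum_list_map_add)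
    ultimately have "(bs, ws, c', q) \<in> durfee_data s n k"
      using c(5-9) l ne len unfolding durfee_data_def by auto
    moreover have "xs = g (bs, ws, c', q)" using c(1) as by (simp add: g_def)
    ultimately show "xs \<in> g ` durfee_data s n k" by blast
  qed
  ultimately show ?thesis by (metis card_image)
qed

section \<open>Runs of consecutive parts and the mex\<close>

definition insert_part :: "nat \<Rightarrow> nat list \<Rightarrow> nat list" where
  "insert_part m xs = filter (\<lambda>x. m < x) xs @ m # filter (\<lambda>x. x \<le> m) xs"

lemma sorted_desc_filter_append:
  "sorted_wrt (\<ge>) xs \<Longrightarrow> filter (\<lambda>x. m < x) xs @ filter (\<lambda>x. x \<le> m) xs = (xs :: nat list)"
proof (induction xs)
  case (Cons x xs)
  show ?case
  proof (cases "m < x")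
    case True
    then show ?thesis using Cons by simp
  next
    case False
    then have "filter (\<lambda>x. m < x) xs = []" using Cons.prems by (fastforce simp: filter_empty_conv)
    then show ?thesis using Cons False by simp
  qed
qed simp

lemma set_insert_part: "set (insert_part m xs) = insert m (set xs)"
  by (auto simp: insert_part_def)

text \<open>
  Removing one copy of the part \<open>m\<close> is a bijection onto all smaller partitions; it is useful for
  properties \<open>Q\<close> that cannot see whether \<open>m\<close> is a part.
\<close>

lemma card_partitions_containing:
  assumes "0 < m" and inv: "\<And>xs. Q (insert_part m xs) \<longleftrightarrow> Q xs"
  shows "card {xs \<in> partitions_big (n + m) (k + (if 1 < m then 1 else 0)). m \<in> set xs \<and> Q xs}
    = card {xs \<in> partitions_big n k. Q xs}"
proof (rule bij_betw_same_card[OF bij_betw_byWitness[where f = "remove1 m" and f' = "insert_part m"], rule_format])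
  have rem: "\<exists>ys zs. xs = ys @ m # zs \<and> remove1 m xs = ys @ zs \<and> insert_part m (remove1 m xs) = xs"
    if "sorted_wrt (\<ge>) xs" "m \<in> set xs" for xs
  proof -
    obtain ys zs where xs: "xs = ys @ m # zs" "m \<notin> set ys"
      using split_list_first[OF \<open>m \<in> set xs\<close>] by blast
    have ys: "\<forall>x \<in> set ys. m < x" and zs: "\<forall>x \<in> set zs. x \<le> m"
      using that xs by (auto simp: sorted_wrt_append order_less_le)
    then have "filter (\<lambda>x. m < x) ys = ys" "filter (\<lambda>x. x \<le> m) ys = []"
      "filter (\<lambda>x. m < x) zs = []" "filter (\<lambda>x. x \<le> m) zs = zs"
      by (auto simp: filter_empty_conv filter_id_conv not_less not_le)
    then show ?thesis using xs by (auto simp: remove1_append insert_part_def)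
  qed
  show "insert_part m (remove1 m xs) = xs"
    if "xs \<in> {xs \<in> partitions_big (n + m) (k + (if 1 < m then 1 else 0)). m \<in> set xs \<and> Q xs}" for xs
    using that rem[of xs] by (auto simp: partitions_big_def partitions_def)
  show "remove1 m (insert_part m xs) = xs" if "xs \<in> {xs \<in> partitions_big n k. Q xs}" for xs
    using that sorted_desc_filter_append[of xs m]
    by (simp add: partitions_big_def partitions_def insert_part_def remove1_append)
  show "remove1 m ` {xs \<in> partitions_big (n + m) (k + (if 1 < m then 1 else 0)). m \<in> set xs \<and> Q xs}
    \<subseteq> {xs \<in> partitions_big n k. Q xs}"
  proof clarify
    fix xs assume a: "xs \<in> partitions_big (n + m) (k + (if 1 < m then 1 else 0))" "m \<in> set xs" "Q xs"
    then obtain ys zs where r: "xs = ys @ m # zs" "remove1 m xs = ys @ zs" "insert_part m (remove1 m xs) = xs"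
      using rem[of xs] by (auto simp: partitions_big_def partitions_def)
    have "Q (remove1 m xs)" using a(3) inv[of "remove1 m xs"] r(3) by simp
    then show "remove1 m xs \<in> partitions_big n k \<and> Q (remove1 m xs)"
      using a(1) unfolding r(2) unfolding r(1)
      by (auto simp: partitions_big_def partitions_def sorted_wrt_append split: if_splits)
  qed
  show "insert_part m ` {xs \<in> partitions_big n k. Q xs}
    \<subseteq> {xs \<in> partitions_big (n + m) (k + (if 1 < m then 1 else 0)). m \<in> set xs \<and> Q xs}"
  proof clarify
    fix xs assume a: "xs \<in> partitions_big n k" "Q xs"
    then have so: "sorted_wrt (\<ge>) xs" by (simp add: partitions_big_def partitions_def)
    note e = sorted_desc_filter_append[OF so, of m]
    have "sum_list (insert_part m xs) = n + m" "num_parts_gt 1 (insert_part m xs) = k + (if 1 < m then 1 else 0)"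
      using arg_cong[OF e, of sum_list] arg_cong[OF e, of "num_parts_gt 1"] a(1)
      by (auto simp: insert_part_def partitions_big_def partitions_def)
    moreover have "sorted_wrt (\<ge>) (insert_part m xs)"
      using so sorted_wrt_filter[OF so] by (auto simp: insert_part_def sorted_wrt_append)
    moreover have "\<forall>x \<in> set (insert_part m xs). 0 < x"
      using a(1) \<open>0 < m\<close> by (auto simp: set_insert_part partitions_big_def partitions_def)
    ultimately show "insert_part m xs \<in> partitions_big (n + m) (k + (if 1 < m then 1 else 0))
      \<and> m \<in> set (insert_part m xs) \<and> Q (insert_part m xs)"
      using a(2) inv by (simp add: set_insert_part partitions_big_def partitions_def)
  qed
qed

lemma mex_above_Suc:
  "mex_above s xs = (if Suc s \<in> set xs then mex_above (Suc s) xs else Suc s)"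
proof (cases "Suc s \<in> set xs")
  case True
  then have "(\<lambda>m. s < m \<and> m \<notin> set xs) = (\<lambda>m. Suc s < m \<and> m \<notin> set xs)"
    by (auto simp: fun_eq_iff order_less_le Suc_le_eq)
  then show ?thesis using True by (simp add: mex_above_def)
next
  case False
  then show ?thesis unfolding mex_above_def by (auto intro: Least_equality)
qed

lemma odd_run_above_Suc:
  "odd_run_above s xs \<longleftrightarrow> Suc s \<in> set xs \<and> \<not> odd_run_above (Suc s) xs"
  by (simp add: odd_run_above_def mex_above_Suc[of s])

lemma odd_run_above_insert_part: "odd_run_above m (insert_part m xs) \<longleftrightarrow> odd_run_above m xs"
proof -
  have "(\<lambda>j. m < j \<and> j \<notin> set (insert_part m xs)) = (\<lambda>j. m < j \<and> j \<notin> set xs)"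
    by (auto simp: fun_eq_iff set_insert_part)
  then show ?thesis by (simp add: odd_run_above_def mex_above_def)
qed

text \<open>
  If \<open>s + 1\<close> is a part, the runs above \<open>s\<close> and above \<open>s + 1\<close> have different parity, and the
  latter is not affected by removing one copy of \<open>s + 1\<close>. That copy counts as a big part exactly
  when \<open>s > 0\<close>.
\<close>

lemma odd_run_recurrence:
  "card {xs \<in> partitions_big (n + Suc s) (k + (if 0 < s then 1 else 0)). odd_run_above s xs}
    + card {xs \<in> partitions_big n k. odd_run_above (Suc s) xs} = card (partitions_big n k)"
  using card_partitions_containing[of "Suc s" "\<lambda>xs. \<not> odd_run_above (Suc s) xs" n k]
    card_partitions_big_split[of n k "odd_run_above (Suc s)"]
  by (simp add: odd_run_above_insert_part odd_run_above_Suc[of s])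

lemma partitions_big_member_bounds:
  assumes "xs \<in> partitions_big n k" "m \<in> set xs" "1 < m"
  shows "m \<le> n" "0 < k"
  using assms member_le_sum_list[of m xs]
  by (auto simp: partitions_big_def partitions_def num_parts_gt_def filter_empty_conv)

text \<open>
  Both sides obey the same recurrence, which lowers \<open>k\<close> while it raises \<open>s\<close>. If \<open>k = 0\<close>, or if
  \<open>n\<close> is too small to subtract \<open>s + 1\<close>, both counts vanish because each condition forces a
  part of size at least \<open>s + 1 > 1\<close>.
\<close>

lemma card_odd_run_eq_shifted_fixed_point:
  assumes "0 < s"
  shows "card {xs \<in> partitions_big n k. odd_run_above s xs}
    = card {xs \<in> partitions_big n k. shifted_fixed_point s xs}"
  using assms
proof (induction k arbitrary: n s)
  have odd: "Suc s \<in> set xs" if "odd_run_above s xs" for s xs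
    using that odd_run_above_Suc[of s xs] by simp
  have fp: "\<exists>m \<in> set xs. Suc s \<le> m" if "shifted_fixed_point s xs" for s xs
    using that unfolding shifted_fixed_point_def by (metis Suc_le_mono le_add2 nth_mem add_Suc)
  {
    case 0
    then have "{xs \<in> partitions_big n 0. odd_run_above s xs} = {}"
      "{xs \<in> partitions_big n 0. shifted_fixed_point s xs} = {}"
      using odd fp partitions_big_member_bounds(2)[of _ n 0] by fastforce+
    then show ?case by (simp only:)
  next
    case (Suc k)
    show ?case
    proof (cases "Suc s \<le> n")
      case True
      then obtain n' where n: "n = n' + Suc s" by (metis le_add_diff_inverse2)
      show ?thesis
        using odd_run_recurrence[of n' s k] shifted_fixed_point_recurrence[of s k n'] Suc.prems
          Suc.IH[of "Suc s" n'] by (simp add: n)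
    next
      case False
      then have "{xs \<in> partitions_big n (Suc k). odd_run_above s xs} = {}"
        "{xs \<in> partitions_big n (Suc k). shifted_fixed_point s xs} = {}"
        using odd fp Suc.prems partitions_big_member_bounds(1)[of _ n "Suc k"] by fastforce+
      then show ?thesis by (simp only:)
    qed
  }
qed

section \<open>Positive and negative crank\<close>

lemma crank_pos_iff:
  assumes "xs \<in> partitions_big n k" "0 < n"
  shows "0 < crank xs \<longleftrightarrow> few_ones 0 xs"
proof -
  have "xs \<noteq> []" and pos: "\<forall>x \<in> set xs. 0 < x"
    using assms by (auto simp: partitions_big_def partitions_def)
  then have "0 < hd xs" "num_parts_gt 0 xs = length xs"
    by (auto intro: num_parts_gt_all)
  then show ?thesis using \<open>xs \<noteq> []\<close> by (auto simp: crank_def few_ones_def)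
qed

text \<open>
  With \<open>\<omega>\<close> ones in \<open>xs\<close>, the extended partition has \<open>\<omega> + 1\<close>, and its crank is negative iff
  at most \<open>\<omega>\<close> parts exceed \<open>\<omega> + 1\<close>.
\<close>

lemma crank_neg_append_one: "crank (xs @ [1]) < 0 \<longleftrightarrow> \<not> few_ones 1 xs"
proof -
  have "num_ones (xs @ [1]) = Suc (num_ones xs)" by (simp add: num_ones_def)
  then show ?thesis by (auto simp: crank_def few_ones_def)
qed

text \<open>
  A partition with negative crank contains a 1, since otherwise its crank is its largest part.
\<close>

lemma card_neg_crank:
  "card {xs \<in> partitions_big (Suc n) k. crank xs < 0} = card {xs \<in> partitions_big n k. \<not> few_ones 1 xs}"
proof -
  have image: "(\<lambda>xs. xs @ [1]) ` {xs \<in> partitions_big n k. \<not> few_ones 1 xs}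
    = {xs \<in> partitions_big (Suc n) k. crank xs < 0}"
  proof (intro equalityI subsetI)
    fix xs assume "xs \<in> (\<lambda>xs. xs @ [1]) ` {xs \<in> partitions_big n k. \<not> few_ones 1 xs}"
    then show "xs \<in> {xs \<in> partitions_big (Suc n) k. crank xs < 0}"
      using crank_neg_append_one
      by (auto simp: partitions_big_def partitions_def sorted_wrt_append Suc_le_eq)
  next
    fix xs assume "xs \<in> {xs \<in> partitions_big (Suc n) k. crank xs < 0}"
    then have x: "xs \<in> partitions_big (Suc n) k" and neg: "crank xs < 0" by auto
    then have "num_ones xs \<noteq> 0" by (auto simp: crank_def split: if_splits)
    moreover have "xs = filter (\<lambda>x. 1 < x) xs @ replicate (num_ones xs) 1"
      using x by (intro filter_big_append_ones) (auto simp: partitions_big_def partitions_def)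
    ultimately obtain ys where ys: "xs = ys @ [1]"
      by (metis append_assoc not0_implies_Suc replicate_Suc replicate_append_same)
    then have "ys \<in> partitions_big n k"
      using x by (auto simp: partitions_big_def partitions_def sorted_wrt_append)
    then show "xs \<in> (\<lambda>xs. xs @ [1]) ` {xs \<in> partitions_big n k. \<not> few_ones 1 xs}"
      using neg ys crank_neg_append_one[of ys] by auto
  qed
  show ?thesis
    unfolding image[symmetric] by (rule card_image) (simp add: inj_on_def)
qed

theorem theorem1:
  fixes n k :: nat
  assumes "n \<ge> 1" and "k \<ge> 1"
  shows "x_e n k = f_fixed n (k + 1) \<and> f_fixed n (k + 1) = m_neg n k \<and> m_neg n k = m_pos n (k + 1)"
proof -
  obtain n' where n: "n = Suc n'" using assms(1) by (cases n) auto
  have restrict: "{xs \<in> partitions n. num_parts_gt 1 xs = j \<and> P xs} = {xs \<in> partitions_big n j. P xs}"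
    for j P by (auto simp: partitions_big_def)
  have "x_e n k = card {xs \<in> partitions_big n k. odd_run_above 0 xs}"
    unfolding x_e_def restrict odd_run_above_def mex_above_def mex_def by simp
  moreover have "f_fixed n (k + 1) = card {xs \<in> partitions_big n (Suc k). shifted_fixed_point 0 xs}"
  proof -
    have "has_fixed_point xs \<longleftrightarrow> shifted_fixed_point 0 xs" for xs
    proof
      assume "has_fixed_point xs"
      then obtain i where "1 \<le> i" "i \<le> length xs" "xs ! (i - 1) = i"
        unfolding has_fixed_point_def by blast
      then show "shifted_fixed_point 0 xs"
        unfolding shifted_fixed_point_def by (intro exI[of _ "i - 1"]) simp
    next
      assume "shifted_fixed_point 0 xs"
      then obtain i where "i < length xs" "xs ! i = Suc i"
        unfolding shifted_fixed_point_def by auto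
      then show "has_fixed_point xs"
        unfolding has_fixed_point_def by (intro exI[of _ "Suc i"]) simp
    qed
    then show ?thesis unfolding f_fixed_def restrict by simp
  qed
  moreover have "m_neg n k = card {xs \<in> partitions_big n k. crank xs < 0}"
    unfolding m_neg_def restrict ..
  moreover have "m_pos n (k + 1) = card {xs \<in> partitions_big n (Suc k). few_ones 0 xs}"
  proof -
    have "{xs \<in> partitions_big n (Suc k). 0 < crank xs} = {xs \<in> partitions_big n (Suc k). few_ones 0 xs}"
      using crank_pos_iff[of _ n "Suc k"] assms(1) by auto
    then show ?thesis unfolding m_pos_def restrict by simp
  qed
  moreover have "card {xs \<in> partitions_big n (Suc k). few_ones 0 xs}
    = card {xs \<in> partitions_big n (Suc k). shifted_fixed_point 0 xs}"
    using card_few_ones_eq_durfee_data card_shifted_fixed_point_eq_durfee_data assms(2) by simp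
  moreover have "card {xs \<in> partitions_big n' k. few_ones 1 xs}
    = card {xs \<in> partitions_big n' k. shifted_fixed_point 1 xs}"
    using card_few_ones_eq_durfee_data card_shifted_fixed_point_eq_durfee_data by simp
  ultimately show ?thesis
    using card_odd_run_eq_shifted_fixed_point[of 1 n' k] odd_run_recurrence[of n' 0 k]
      shifted_fixed_point_recurrence[of 0 k n'] card_neg_crank[of n' k]
      card_partitions_big_split[of n' k "few_ones 1"] assms(2) by (simp add: n)
qed

end
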